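(* Let $I\subset\mathbb{R}$ be an interval with interior $I^{\circ}$, let $f:I^{\circ}\to\mathbb{R}$ be differentiable on $I^{\circ}$, and let $a,b\in I^{\circ}$ with $a<b$. If $|f'|^{2}$ is convex on $[a,b]$, then $$\left|f\left(\frac{a+b}{2}\right)-\frac{1}{b-a}\int_{a}^{b}f(x)\,dx\right|\leq\frac{b-a}{\sqrt{6}}\left(\frac{|f'(a)|^{2}+|f'(b)|^{2}}{2}\right)^{\frac12}.$$
   Context: A function $g:[a,b]\to\mathbb{R}$ is convex if $g(tx+(1-t)y)\leq t g(x)+(1-t)g(y)$ for all $x,y\in[a,b]$ and $t\in[0,1]$. *)

theory Defs
  imports "HOL-Analysis.Analysis"
begin

end

theory Submission
  imports Defs
begin

text \<open>
  Put \<open>m = (a + b) / 2\<close>, \<open>u = x - m\<close> and \<open>c\<^sup>2 = (\<bar>f' a\<bar>\<^sup>2 + \<bar>f' b\<bar>\<^sup>2) / 2\<close>. Convexity bounds \<open>\<bar>f'\<bar>\<^sup>2\<close> by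
  the chord \<open>c\<^sup>2 + s u\<close>, and AM-GM turns this into the affine bound \<open>\<bar>f'\<bar> \<le> c + s u / (2 c)\<close>.
  Integrating the bound from \<open>m\<close> controls \<open>\<bar>f x - f m\<bar>\<close>; in the mean over \<open>[a, b]\<close> the term in \<open>s\<close>
  cancels by symmetry, which leaves \<open>c (b - a) / 4\<close>, and \<open>1 / 4 \<le> 1 / sqrt 6\<close>.
\<close>

text \<open>The factor 1/4 arises because \<open>\<bar>x - m\<bar>\<close> has mean
  \<open>(b - a) / 4\<close> over \<open>{a..b}\<close>. The slope \<open>s\<close> is left free, so
  a chord of any inclination may be used.\<close>

lemma midpoint_error_affine_derivative_bound:
  fixes f f' :: "real \<Rightarrow> real" and a b c s :: real
  assumes "a < b"
    and der: "\<And>x. x \<in> {a..b} \<Longrightarrow> (f has_real_derivative f' x) (at x)"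
    and bound: "\<And>x. x \<in> {a..b} \<Longrightarrow> \<bar>f' x\<bar> \<le> c + s * (x - (a + b) / 2)"
  shows "\<bar>f ((a + b) / 2) - 1 / (b - a) * integral {a..b} f\<bar> \<le> c * (b - a) / 4"
proof -
  define m where "m = (a + b) / 2"
  \<comment> \<open>\<open>G\<close> is the antiderivative of the affine majorant that vanishes at
    \<open>m\<close>, and \<open>H\<close> is the antiderivative of \<open>G\<close> that vanishes
    there.\<close>
  define G where "G x = c * (x - m) + s * (x - m)\<^sup>2 / 2" for x
  define H where "H x = c * (x - m)\<^sup>2 / 2 + s * (x - m) ^ 3 / 6" for x
  have m: "a \<le> m" "m \<le> b"
    using \<open>a < b\<close> by (simp_all add: m_def)
  have dG: "(G has_real_derivative c + s * (x - m)) (at x)" for x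
    unfolding G_def by (auto intro!: derivative_eq_intros)
  have dH: "(H has_real_derivative G x) (at x)" for x
    unfolding G_def H_def by (auto intro!: derivative_eq_intros simp: power2_eq_square)
  have "G m = 0"
    by (simp add: G_def)
  \<comment> \<open>Both \<open>G - f\<close> and \<open>G + f\<close> have nonnegative derivative.
    Arguing by monotonicity avoids integrating \<open>f'\<close>, whose integrability is not
    assumed.\<close>
  have incr: "\<bar>f y - f x\<bar> \<le> G y - G x" if "a \<le> x" "x \<le> y" "y \<le> b" for x y
  proof -
    have *: "((\<lambda>t. G t - f t) has_real_derivative c + s * (z - m) - f' z) (at z)"
      "((\<lambda>t. G t + f t) has_real_derivative c + s * (z - m) + f' z) (at z)"
      "\<bar>f' z\<bar> \<le> c + s * (z - m)" if "x \<le> z" "z \<le> y" for z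
      using that \<open>a \<le> x\<close> \<open>y \<le> b\<close> bound[of z]
      by (auto intro!: DERIV_diff DERIV_add dG der simp flip: m_def)
    have "G x - f x \<le> G y - f y"
      using \<open>x \<le> y\<close> *(1,3)
      by (intro DERIV_nonneg_imp_nondecreasing[where f = "\<lambda>t. G t - f t"]) fastforce+
    moreover have "0 \<le> c + s * (z - m) + f' z" if "x \<le> z" "z \<le> y" for z
      using *(3)[OF that] by linarith
    then have "G x + f x \<le> G y + f y"
      using \<open>x \<le> y\<close> *(2)
      by (intro DERIV_nonneg_imp_nondecreasing[where f = "\<lambda>t. G t + f t"]) blast+
    ultimately show ?thesis by linarith
  qed
  have "continuous_on {a..b} f"
    using der by (meson DERIV_atLeastAtMost_imp_continuous_on atLeastAtMost_iff)
  then have int: "f integrable_on {a..b}"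
    by (rule integrable_continuous_real)
  have int': "(\<lambda>x. f x - f m) integrable_on {u..v}" if "a \<le> u" "v \<le> b" for u v
    using that by (intro integrable_diff integrable_subinterval_real[OF int]) auto
  have G_int: "(G has_integral H v - H u) {u..v}" if "u \<le> v" for u v
    using that dH
    by (intro fundamental_theorem_of_calculus)
      (auto intro: has_field_derivative_at_within simp: has_real_derivative_iff_has_vector_derivative[symmetric])
  have right: "\<bar>integral {m..b} (\<lambda>x. f x - f m)\<bar> \<le> H b - H m"
    using integral_norm_bound_integral[OF int'[of m b] has_integral_integrable[OF G_int[of m b]]]
      incr[of m] m \<open>G m = 0\<close> integral_unique[OF G_int[of m b]] by auto
  \<comment> \<open>To the left of \<open>m\<close> the increment runs from \<open>x\<close> up to
    \<open>m\<close>, so the majorant is \<open>G m - G x = - G x\<close>.\<close>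
  have "\<bar>f x - f m\<bar> \<le> - G x" if "x \<in> {a..m}" for x
    using incr[of x m] that m \<open>G m = 0\<close> by (auto simp: abs_minus_commute)
  then have left: "\<bar>integral {a..m} (\<lambda>x. f x - f m)\<bar> \<le> H a - H m"
    using integral_norm_bound_integral[OF int'[of a m] has_integral_integrable[OF has_integral_neg[OF G_int[of a m]]]]
      m integral_unique[OF has_integral_neg[OF G_int[of a m]]] by auto
  have "integral {a..b} f - (b - a) * f m = integral {a..b} (\<lambda>x. f x - f m)"
    using \<open>a < b\<close> Henstock_Kurzweil_Integration.integral_diff[OF int integrable_const_ivl[of "f m"]] by simp
  also have "\<dots> = integral {a..m} (\<lambda>x. f x - f m) + integral {m..b} (\<lambda>x. f x - f m)"
    using Henstock_Kurzweil_Integration.integral_combine[OF m int'[of a b]] by simp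
  finally have "\<bar>integral {a..b} f - (b - a) * f m\<bar> \<le> H a + H b - 2 * H m"
    using left right by linarith
  \<comment> \<open>Since \<open>a\<close> and \<open>b\<close> are symmetric about
    \<open>m\<close>, the cubic terms cancel and the quadratic ones add up; \<open>H m\<close> is
    0.\<close>
  also have "H a + H b - 2 * H m = c * (b - a) / 4 * (b - a)"
    by (simp add: H_def m_def field_simps power2_eq_square power3_eq_cube)
  finally have "\<bar>integral {a..b} f - (b - a) * f m\<bar> / (b - a) \<le> c * (b - a) / 4"
    using \<open>a < b\<close> by (simp add: pos_divide_le_eq)
  moreover have "f m - 1 / (b - a) * integral {a..b} f = - ((integral {a..b} f - (b - a) * f m) / (b - a))"
    using \<open>a < b\<close> by (simp add: field_simps)
  ultimately show ?thesis
    using \<open>a < b\<close> unfolding m_def[symmetric] by simp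
qed

theorem theorem2:
  fixes f :: "real \<Rightarrow> real" and I :: "real set" and a b :: real
  assumes "is_interval I"
    and "f differentiable_on interior I"
    and "a \<in> interior I" and "b \<in> interior I" and "a < b"
    and "convex_on {a..b} (\<lambda>x. \<bar>deriv f x\<bar> ^ 2)"
  shows "\<bar>f ((a + b) / 2) - 1 / (b - a) * integral {a..b} f\<bar>
           \<le> (b - a) / sqrt 6 * ((\<bar>deriv f a\<bar> ^ 2 + \<bar>deriv f b\<bar> ^ 2) / 2) powr (1 / 2)"
proof -
  define A where "A = (deriv f a)\<^sup>2"
  define B where "B = (deriv f b)\<^sup>2"
  \<comment> \<open>The chord of the squared derivative has slope \<open>s\<close> and takes the
    value \<open>c\<^sup>2\<close> at the midpoint.\<close>
  define c where "c = sqrt ((A + B) / 2)"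
  define s where "s = (B - A) / (b - a)"
  have AB: "0 \<le> A" "0 \<le> B"
    by (simp_all add: A_def B_def)
  have c: "0 \<le> c" "c\<^sup>2 = (A + B) / 2"
    using AB by (simp_all add: c_def)
  have "is_interval (interior I)"
    using assms(1) by (simp add: is_interval_convex_1 convex_interior)
  then have sub: "{a..b} \<subseteq> interior I"
    using assms(3,4) by (meson atLeastAtMost_iff mem_is_interval_1_I subsetI)
  have der: "(f has_real_derivative deriv f x) (at x)" if "x \<in> {a..b}" for x
  proof -
    have "x \<in> interior I"
      using sub that by blast
    then have "f differentiable (at x)"
      using assms(2) at_within_open[OF _ open_interior] unfolding differentiable_on_def by metis
    then show ?thesis
      using DERIV_deriv_iff_real_differentiable by blast
  qed
  have bound: "\<bar>deriv f x\<bar> \<le> c + s / (2 * c) * (x - (a + b) / 2)" if x: "x \<in> {a..b}" for x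
  proof -
    define t where "t = (x - a) / (b - a)"
    have t01: "0 \<le> t" "t \<le> 1" and "t * (b - a) = x - a"
      using x \<open>a < b\<close> by (auto simp: t_def)
    then have t: "x = (1 - t) *\<^sub>R a + t *\<^sub>R b"
      unfolding real_scaleR_def by algebra
    have "(deriv f x)\<^sup>2 \<le> (1 - t) * A + t * B"
      using convex_onD[OF assms(6) t01, of a b] \<open>a < b\<close> unfolding t A_def B_def by simp
    also have "\<dots> = c\<^sup>2 + s * (x - (a + b) / 2)"
      using \<open>a < b\<close> unfolding c(2) s_def t_def by (simp add: divide_simps) algebra
    finally have le: "(deriv f x)\<^sup>2 \<le> c\<^sup>2 + s * (x - (a + b) / 2)" .
    show ?thesis
    proof (cases "c = 0")
      \<comment> \<open>Here \<open>s / (2 * c)\<close> is 0 by the convention for division by zero,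
        so the claim is that the derivative vanishes; it does, because the chord is identically
        0.\<close>
      case True
      then have "A = 0" "B = 0"
        using c(2) AB by auto
      then show ?thesis
        using le True by (simp add: s_def)
    next
      case False
      \<comment> \<open>AM-GM with weight \<open>c\<close> linearizes the square root of the chord:
        the resulting bound is its tangent at the midpoint.\<close>
      have "2 * c * \<bar>deriv f x\<bar> \<le> c\<^sup>2 + (deriv f x)\<^sup>2"
        using sum_squares_bound[of c "\<bar>deriv f x\<bar>"] by simp
      then have "2 * c * \<bar>deriv f x\<bar> \<le> 2 * c\<^sup>2 + s * (x - (a + b) / 2)"
        using le by linarith
      also have "\<dots> = 2 * c * (c + s / (2 * c) * (x - (a + b) / 2))"
        using False by (simp add: field_simps power2_eq_square)
      finally show ?thesis
        using False c(1) by simp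
    qed
  qed
  have "\<bar>f ((a + b) / 2) - 1 / (b - a) * integral {a..b} f\<bar> \<le> c * (b - a) / 4"
    by (rule midpoint_error_affine_derivative_bound[OF \<open>a < b\<close> der bound])
  \<comment> \<open>The constant 1/4 obtained so far is sharper than the one claimed, as
    \<open>sqrt 6 \<le> 4\<close>.\<close>
  also have "\<dots> \<le> (b - a) / sqrt 6 * c"
  proof -
    have "sqrt 6 \<le> 4"
      by (rule real_le_lsqrt) auto
    then have "1 / 4 \<le> 1 / sqrt 6"
      by (intro divide_left_mono) auto
    then have "(b - a) * c * (1 / 4) \<le> (b - a) * c * (1 / sqrt 6)"
      using \<open>a < b\<close> c(1) by (intro mult_left_mono) auto
    then show ?thesis
      by (simp add: mult.commute)
  qed
  also have "c = ((\<bar>deriv f a\<bar> ^ 2 + \<bar>deriv f b\<bar> ^ 2) / 2) powr (1 / 2)"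
    using AB by (simp add: c_def A_def B_def powr_half_sqrt)
  finally show ?thesis .
qed

end
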